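(* Let $\mathcal{C}\subseteq\mathbb{N}^p$ be a nonzero affine integer cone and let $\preceq$ be a total order on $\mathbb{N}^p$ such that $\mathcal{N}(x)$ is finite for every $x\in\mathcal{C}$. If $g$ and $n$ are two positive integers, then $$\mathfrak{C}(gen=g,\,se=n)=\mathfrak{C}(Fb=f,\,gen=g),$$ where $f\in\mathcal{C}$ is the element satisfying $\mathcal{N}(f)=g+n-1$.
   Context: $\mathbb{N}$ contains $0$. An affine integer cone $\mathcal{C}\subseteq\mathbb{N}^p$ is a set $L(A)\cap\mathbb{N}^p$ with $A\subseteq\mathcal{C}$ finite and non-empty, where $L(A)$ is the set of non-negative real linear combinations of elements of $A$. A $\mathcal{C}$-semigroup is a submonoid $S\subseteq\mathcal{C}$ (containing $0$) with $\mathcal{C}\setminus S$ finite; its genus is $\mathrm{g}(S)=\sharp(\mathcal{C}\setminus S)$, where $\sharp$ denotes cardinality. A total order on $\mathbb{N}^p$ means a total order relation compatible with addition and satisfying $0\preceq x$ for all $x$. For $S\neq\mathcal{C}$, $\mathrm{Fb}(S)=\max_\preceq(\mathcal{C}\setminus S)$, and by convention $\mathrm{Fb}(\mathcal{C})=(-1,\ldots,-1)$. The number of small elements is $\mathrm{n}(S)=\sharp\{s\in S\mid s\prec\mathrm{Fb}(S)\}$. For $f\in\mathcal{C}$, $\mathcal{N}(f)=\sharp\{x\in\mathcal{C}\setminus\{0\}\mid x\preceq f\}$. $\mathfrak{C}(gen=g,se=n)$ is the set of $\mathcal{C}$-semigroups $S$ with $\mathrm{g}(S)=g$ and $\mathrm{n}(S)=n$;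 $\mathfrak{C}(Fb=f,gen=g)$ is the set of $\mathcal{C}$-semigroups with Frobenius element $f$ and genus $g$. *)

theory Defs
  imports "HOL-Analysis.Finite_Cartesian_Product"
begin

definition real_vec :: "nat ^ 'p \<Rightarrow> real ^ 'p" where
  "real_vec x = (\<chi> i. real (x $ i))"

definition int_vec :: "nat ^ 'p \<Rightarrow> int ^ 'p" where
  "int_vec x = (\<chi> i. int (x $ i))"

(* Only meant for finite A: the sum is 0 when A is infinite. *)
definition nonneg_combs :: "(nat ^ 'p) set \<Rightarrow> (real ^ 'p) set" where
  "nonneg_combs A =
     {v. \<exists>q. (\<forall>a\<in>A. 0 \<le> q a) \<and> v = (\<Sum>a\<in>A. q a *\<^sub>R real_vec a)}"

definition affine_integer_cone :: "(nat ^ 'p) set \<Rightarrow> bool" where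
  "affine_integer_cone C \<longleftrightarrow>
     (\<exists>A. finite A \<and> A \<noteq> {} \<and> A \<subseteq> C \<and> C = {x. real_vec x \<in> nonneg_combs A})"

definition additive_total_order :: "(nat ^ 'p \<Rightarrow> nat ^ 'p \<Rightarrow> bool) \<Rightarrow> bool" where
  "additive_total_order le \<longleftrightarrow>
     class.linorder le (\<lambda>x y. le x y \<and> x \<noteq> y) \<and>
     (\<forall>x y z. le x y \<longrightarrow> le (x + z) (y + z)) \<and>
     (\<forall>x. le 0 x)"

definition C_semigroup :: "(nat ^ 'p) set \<Rightarrow> (nat ^ 'p) set \<Rightarrow> bool" where
  "C_semigroup C S \<longleftrightarrow>
     S \<subseteq> C \<and> 0 \<in> S \<and> (\<forall>x\<in>S. \<forall>y\<in>S. x + y \<in> S) \<and> finite (C - S)"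

definition genus :: "(nat ^ 'p) set \<Rightarrow> (nat ^ 'p) set \<Rightarrow> nat" where
  "genus C S = card (C - S)"

definition is_max ::
  "(nat ^ 'p \<Rightarrow> nat ^ 'p \<Rightarrow> bool) \<Rightarrow> (nat ^ 'p) set \<Rightarrow> nat ^ 'p \<Rightarrow> bool" where
  "is_max le X m \<longleftrightarrow> m \<in> X \<and> (\<forall>x\<in>X. le x m)"

(* Integer-valued, so as to accommodate the convention Fb(C) = (-1, ..., -1). *)
definition Fb ::
  "(nat ^ 'p) set \<Rightarrow> (nat ^ 'p \<Rightarrow> nat ^ 'p \<Rightarrow> bool) \<Rightarrow> (nat ^ 'p) set \<Rightarrow> int ^ 'p" where
  "Fb C le S = (if S = C then (\<chi> i. - 1) else int_vec (THE m. is_max le (C - S) m))"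

(* The order lives on vectors of naturals, so Fb(S) is compared through its
   preimage under int_vec. For S = C there is none, and no element is small. *)
definition small_elements ::
  "(nat ^ 'p) set \<Rightarrow> (nat ^ 'p \<Rightarrow> nat ^ 'p \<Rightarrow> bool) \<Rightarrow> (nat ^ 'p) set \<Rightarrow> (nat ^ 'p) set" where
  "small_elements C le S = {s \<in> S. \<exists>f. Fb C le S = int_vec f \<and> le s f \<and> s \<noteq> f}"

definition num_small ::
  "(nat ^ 'p) set \<Rightarrow> (nat ^ 'p \<Rightarrow> nat ^ 'p \<Rightarrow> bool) \<Rightarrow> (nat ^ 'p) set \<Rightarrow> nat" where
  "num_small C le S = card (small_elements C le S)"

definition nonzero_below ::
  "(nat ^ 'p) set \<Rightarrow> (nat ^ 'p \<Rightarrow> nat ^ 'p \<Rightarrow> bool) \<Rightarrow> nat ^ 'p \<Rightarrow> (nat ^ 'p) set" where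
  "nonzero_below C le f = {x \<in> C - {0}. le x f}"

definition num_below ::
  "(nat ^ 'p) set \<Rightarrow> (nat ^ 'p \<Rightarrow> nat ^ 'p \<Rightarrow> bool) \<Rightarrow> nat ^ 'p \<Rightarrow> nat" where
  "num_below C le f = card (nonzero_below C le f)"

definition semigroups_gen_se ::
  "(nat ^ 'p) set \<Rightarrow> (nat ^ 'p \<Rightarrow> nat ^ 'p \<Rightarrow> bool) \<Rightarrow> nat \<Rightarrow> nat \<Rightarrow> (nat ^ 'p) set set" where
  "semigroups_gen_se C le g n =
     {S. C_semigroup C S \<and> genus C S = g \<and> num_small C le S = n}"

definition semigroups_Fb_gen ::
  "(nat ^ 'p) set \<Rightarrow> (nat ^ 'p \<Rightarrow> nat ^ 'p \<Rightarrow> bool) \<Rightarrow> int ^ 'p \<Rightarrow> nat \<Rightarrow> (nat ^ 'p) set set" where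
  "semigroups_Fb_gen C le f g =
     {S. C_semigroup C S \<and> Fb C le S = f \<and> genus C S = g}"

end

theory Submission
  imports Defs
begin

text \<open>If \<open>m\<close> is the largest gap of \<open>S\<close>, then the elements of \<open>C\<close> up to \<open>m\<close>, zero
  included, are exactly the gaps and the small elements, so that
  \<open>\<N>(m) + 1 = g(S) + n(S)\<close>. Since \<open>\<N>\<close> is injective on \<open>C\<close>, fixing the number of
  small elements and fixing the Frobenius element amount to the same once the genus is fixed.\<close>

lemma affine_integer_cone_zero:
  assumes "affine_integer_cone C"
  shows "0 \<in> C"
proof -
  obtain A where C: "C = {x. real_vec x \<in> nonneg_combs A}"
    using assms unfolding affine_integer_cone_def by blast
  have "real_vec (0 :: nat ^ 'a) = (\<Sum>a\<in>A. 0 *\<^sub>R real_vec a)"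
    by (simp add: real_vec_def vec_eq_iff)
  then show ?thesis
    unfolding C nonneg_combs_def by (auto intro!: exI[of _ "\<lambda>_. 0"])
qed

text \<open>Adding the coefficients of the two combinations, generator by generator, gives a
  non-negative combination for the sum.\<close>

lemma affine_integer_cone_add:
  assumes "affine_integer_cone C" and "x \<in> C" and "y \<in> C"
  shows "x + y \<in> C"
proof -
  obtain A where C: "C = {x. real_vec x \<in> nonneg_combs A}"
    using assms(1) unfolding affine_integer_cone_def by blast
  obtain q where q: "\<forall>a\<in>A. 0 \<le> q a" "real_vec x = (\<Sum>a\<in>A. q a *\<^sub>R real_vec a)"
    using assms(2) unfolding C nonneg_combs_def by blast
  obtain r where r: "\<forall>a\<in>A. 0 \<le> r a" "real_vec y = (\<Sum>a\<in>A. r a *\<^sub>R real_vec a)"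
    using assms(3) unfolding C nonneg_combs_def by blast
  have "real_vec (x + y) = real_vec x + real_vec y"
    by (simp add: real_vec_def vec_eq_iff)
  also have "\<dots> = (\<Sum>a\<in>A. (q a + r a) *\<^sub>R real_vec a)"
    by (simp add: q(2) r(2) scaleR_add_left sum.distrib)
  finally show ?thesis
    using q(1) r(1) unfolding C nonneg_combs_def
    by (auto intro!: exI[of _ "\<lambda>a. q a + r a"])
qed

lemma additive_total_order_linorder:
  "additive_total_order le \<Longrightarrow> class.linorder le (\<lambda>x y. le x y \<and> x \<noteq> y)"
  by (simp add: additive_total_order_def)

lemma int_vec_eq_iff [simp]: "int_vec x = int_vec y \<longleftrightarrow> x = y"
  by (simp add: int_vec_def vec_eq_iff)

lemma ex_is_max:
  assumes "additive_total_order le" and "finite X" and "X \<noteq> {}"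
  shows "\<exists>m. is_max le X m"
proof -
  interpret o: linorder le "\<lambda>x y. le x y \<and> x \<noteq> y"
    by (rule additive_total_order_linorder) fact
  show ?thesis
    using assms(2,3) o.Max_in o.Max_ge unfolding is_max_def by blast
qed

text \<open>By antisymmetry a maximum is unique, so the definite description returns
  \<open>m\<close>. As \<open>m\<close> is a gap, the convention for \<open>S = C\<close> does not
  come into play.\<close>

lemma Fb_eq_int_vec:
  assumes "additive_total_order le" and "is_max le (C - S) m"
  shows "Fb C le S = int_vec m"
proof -
  interpret o: linorder le "\<lambda>x y. le x y \<and> x \<noteq> y"
    by (rule additive_total_order_linorder) fact
  have "(THE m. is_max le (C - S) m) = m"
    using assms(2) o.order.antisym by (intro the_equality) (auto simp: is_max_def)
  moreover have "S \<noteq> C"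
    using assms(2) by (auto simp: is_max_def)
  ultimately show ?thesis
    by (simp add: Fb_def)
qed

lemma num_below_strict_mono:
  assumes "additive_total_order le" and "finite (nonzero_below C le y)"
    and "x \<in> C" and "y \<in> C" and "le x y" and "x \<noteq> y"
  shows "num_below C le x < num_below C le y"
proof -
  interpret o: linorder le "\<lambda>x y. le x y \<and> x \<noteq> y"
    by (rule additive_total_order_linorder) fact
  \<comment> \<open>The count omits 0, so \<open>y\<close> must be nonzero to be counted below
    itself. It lies strictly above \<open>x\<close>, whereas 0 is least.\<close>
  have "y \<noteq> 0"
    using assms(1,5,6) o.order.antisym unfolding additive_total_order_def by blast
  then have "y \<in> nonzero_below C le y - nonzero_below C le x"
    using assms(4-6) o.order.antisym by (auto simp: nonzero_below_def)
  moreover have "nonzero_below C le x \<subseteq> nonzero_below C le y"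
    using assms(5) o.order.trans unfolding nonzero_below_def by blast
  ultimately show ?thesis
    unfolding num_below_def using assms(2) by (intro psubset_card_mono) auto
qed

lemma inj_on_num_below:
  assumes "additive_total_order le" and "\<forall>x\<in>C. finite (nonzero_below C le x)"
  shows "inj_on (num_below C le) C"
proof (rule inj_onI, rule ccontr)
  interpret o: linorder le "\<lambda>x y. le x y \<and> x \<noteq> y"
    by (rule additive_total_order_linorder) fact
  fix x y
  assume "x \<in> C" "y \<in> C" "num_below C le x = num_below C le y" "x \<noteq> y"
  then show False
    using num_below_strict_mono[OF assms(1), of C x y] num_below_strict_mono[OF assms(1), of C y x]
      assms(2) o.linear[of x y] by auto
qed

text \<open>The count starts at 0, and every element of \<open>C\<close> has an immediate successor
  in \<open>C\<close>, whose count is larger by exactly one. Hence no value is skipped.\<close>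

lemma ex_num_below_eq:
  assumes cone: "affine_integer_cone C" and "C \<noteq> {0}"
    and order: "additive_total_order le"
    and fin: "\<forall>x\<in>C. finite (nonzero_below C le x)"
  shows "\<exists>f\<in>C. num_below C le f = k"
proof (induction k)
  interpret o: linorder le "\<lambda>x y. le x y \<and> x \<noteq> y"
    by (rule additive_total_order_linorder) fact
  have least: "le 0 x" for x
    using order by (simp add: additive_total_order_def)
  {
    case 0
    have "nonzero_below C le 0 = {}"
      using least o.order.antisym by (auto simp: nonzero_below_def)
    then show ?case
      using affine_integer_cone_zero[OF cone] by (intro bexI[of _ 0]) (auto simp: num_below_def)
  next
    case (Suc k)
    then obtain f where f: "f \<in> C" "num_below C le f = k"
      by blast
    obtain a where a: "a \<in> C" "a \<noteq> 0"
      using affine_integer_cone_zero[OF cone] \<open>C \<noteq> {0}\<close> by blast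
    \<comment> \<open>A nonzero \<open>a\<close> gives an element of \<open>C\<close> strictly above
      \<open>f\<close>, by compatibility of the order with addition.\<close>
    let ?y = "a + f"
    have "le (0 + f) ?y"
      using least[of a] order unfolding additive_total_order_def by blast
    with a f have y: "?y \<in> C" "le f ?y" "?y \<noteq> f"
      by (auto intro: affine_integer_cone_add[OF cone])
    have nonzero: "x \<noteq> 0" if "le f x" "x \<noteq> f" for x
      using that least[of f] o.order.antisym by blast
    \<comment> \<open>Bounding the elements above \<open>f\<close> by \<open>?y\<close> makes the
      set finite, so that its minimum exists; this minimum is the successor of \<open>f\<close> in
      \<open>C\<close>.\<close>
    let ?X = "{x \<in> C. le f x \<and> x \<noteq> f \<and> le x ?y}"
    have X: "finite ?X" "?X \<noteq> {}"
      using y fin nonzero by (auto intro: finite_subset[of _ "nonzero_below C le ?y"]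
          simp: nonzero_below_def)
    define h where "h = o.Min ?X"
    have h: "h \<in> ?X" and h_le: "\<And>x. x \<in> ?X \<Longrightarrow> le h x"
      unfolding h_def using X o.Min_in o.Min_le by blast+
    have "nonzero_below C le h = insert h (nonzero_below C le f)" (is "?L = ?R")
    proof
      show "?L \<subseteq> ?R"
      proof
        fix x
        assume "x \<in> ?L"
        then have x: "x \<in> C" "x \<noteq> 0" "le x h"
          by (auto simp: nonzero_below_def)
        show "x \<in> ?R"
        proof (cases "le x f")
          case True
          with x show ?thesis
            by (simp add: nonzero_below_def)
        next
          case False
          \<comment> \<open>Here \<open>x\<close> lies strictly above \<open>f\<close> and at most
            at \<open>h\<close>, hence at most at \<open>?y\<close>; minimality of \<open>h\<close>
            then forces \<open>x = h\<close>.\<close>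
          then have "x \<in> ?X"
            using x h o.linear[of x f] o.order.trans[of x h ?y] by auto
          then show ?thesis
            using h_le x(3) o.order.antisym by blast
        qed
      qed
      show "?R \<subseteq> ?L"
        using h nonzero o.order.trans[of _ f h] by (auto simp: nonzero_below_def)
    qed
    moreover have "h \<notin> nonzero_below C le f"
      using h o.order.antisym by (auto simp: nonzero_below_def)
    ultimately have "num_below C le h = Suc k"
      using f fin by (auto simp: num_below_def)
    with h show ?case
      by blast
  }
qed

lemma num_below_eq_genus_plus_num_small:
  assumes order: "additive_total_order le" and S: "C_semigroup C S"
    and max: "is_max le (C - S) m" and fin: "finite (nonzero_below C le m)"
  shows "Suc (num_below C le m) = genus C S + num_small C le S"
proof -
  interpret o: linorder le "\<lambda>x y. le x y \<and> x \<noteq> y"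
    by (rule additive_total_order_linorder) fact
  have least: "le 0 x" for x
    using order by (simp add: additive_total_order_def)
  have small: "small_elements C le S = {s \<in> S. le s m \<and> s \<noteq> m}"
    by (auto simp: small_elements_def Fb_eq_int_vec[OF order max])
  \<comment> \<open>No gap exceeds \<open>m\<close>, and \<open>m\<close> is itself a gap. The added
    0 is a small element: it lies in \<open>S\<close>, so it differs from \<open>m\<close>, and it
    is least. It accounts for the \<open>Suc\<close> in the statement.\<close>
  have eq: "insert 0 (nonzero_below C le m) = (C - S) \<union> small_elements C le S"
    using S max least unfolding small C_semigroup_def is_max_def nonzero_below_def by auto
  have "finite (small_elements C le S)"
    using fin eq by (metis finite_Un finite_insert)
  moreover have "finite (C - S)" "(C - S) \<inter> small_elements C le S = {}"
    using S by (auto simp: C_semigroup_def small)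
  ultimately have "card (insert 0 (nonzero_below C le m)) = genus C S + num_small C le S"
    unfolding eq genus_def num_small_def by (simp add: card_Un_disjoint)
  then show ?thesis
    using fin by (simp add: num_below_def nonzero_below_def)
qed

theorem corollary9:
  fixes C :: "(nat ^ 'p) set"
    and le :: "nat ^ 'p \<Rightarrow> nat ^ 'p \<Rightarrow> bool"
    and g n :: nat
  assumes "affine_integer_cone C"
    and "C \<noteq> {0}"
    and "additive_total_order le"
    and "\<forall>x\<in>C. finite (nonzero_below C le x)"
    and "0 < g"
    and "0 < n"
  shows "(\<exists>!f. f \<in> C \<and> num_below C le f = g + n - 1) \<and>
         (\<forall>f\<in>C. num_below C le f = g + n - 1 \<longrightarrow>
            semigroups_gen_se C le g n = semigroups_Fb_gen C le (int_vec f) g)"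
proof (intro conjI ballI impI)
  have inj: "inj_on (num_below C le) C"
    using inj_on_num_below assms(3,4) by blast
  show "\<exists>!f. f \<in> C \<and> num_below C le f = g + n - 1"
    using ex_num_below_eq[OF assms(1-4), of "g + n - 1"] inj unfolding inj_on_def by metis
  fix f
  assume f: "f \<in> C" "num_below C le f = g + n - 1"
  have "num_small C le S = n \<longleftrightarrow> Fb C le S = int_vec f"
    if S: "C_semigroup C S" and g: "genus C S = g" for S
  proof -
    \<comment> \<open>Positive genus excludes \<open>S = C\<close>, so the Frobenius element is a
      genuine largest gap rather than the conventional value.\<close>
    have "finite (C - S)" "C - S \<noteq> {}"
      using S g \<open>0 < g\<close> by (auto simp: C_semigroup_def genus_def card_gt_0_iff)
    then obtain m where m: "is_max le (C - S) m"
      using ex_is_max[OF assms(3)] by blast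
    then have mC: "m \<in> C"
      by (simp add: is_max_def)
    have "Suc (num_below C le m) = g + num_small C le S"
      using num_below_eq_genus_plus_num_small[OF assms(3) S m] mC assms(4) g by simp
    \<comment> \<open>Since \<open>g\<close> is positive, the subtraction in
      \<open>g + n - 1\<close> is not truncated, and
      \<open>Suc (num_below C le f) = g + n\<close>.\<close>
    then have "num_small C le S = n \<longleftrightarrow> num_below C le m = num_below C le f"
      using f(2) \<open>0 < g\<close> by auto
    also have "\<dots> \<longleftrightarrow> m = f"
      using inj_on_eq_iff[OF inj mC f(1)] .
    finally show ?thesis
      by (simp add: Fb_eq_int_vec[OF assms(3) m])
  qed
  then show "semigroups_gen_se C le g n = semigroups_Fb_gen C le (int_vec f) g"
    unfolding semigroups_gen_se_def semigroups_Fb_gen_def by blast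
qed

end
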